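(* For every knot $K$ that has a doubly transvergent diagram, $$\operatorname{sim}(K)\ \ge\ \begin{cases} 3\operatorname{cr}(K)+1, & \text{if } \operatorname{cr}(K) \text{ is odd},\\ 3\operatorname{cr}(K)+2, & \text{if } \operatorname{cr}(K)\text{ is even.}\end{cases}$$ In particular, $\operatorname{sim}(K)=3\operatorname{cr}(K)$ is never possible.
   Context: Knots are polygonal or smooth knots in $\mathbb{S}^3=\mathbb{R}^3\cup\{\infty\}$, considered up to knot type; $\operatorname{cr}(K)$ is the usual (minimal) crossing number of $K$. A strong inversion of a knot $K$ is a smooth involution of the pair $(\mathbb{S}^3,K)$ that preserves the orientation of $\mathbb{S}^3$ and reverses the orientation of $K$. Symmetric embeddings. Let $\rho_x,\rho_y$ be the half rotations (by angle $\pi$) of $\mathbb{R}^3$ about the $x$-axis and the $y$-axis. A symmetric embedding of a knot type is a representative $K\subset\mathbb{R}^3$ such that $\rho_x(K)=K$, $\rho_y(K)=K$, and both $\rho_x,\rho_y$ reverse the orientation of $K$ (that is, both are strong inversions of $K$). Then $\rho_z=\rho_x\rho_y$, the half rotation about the $z$-axis, maps $K$ to itself preserving its orientation. A diagram obtained by projecting such a $K$ along the $z$-axis to the $x$-$y$-plane is called doubly transvergent (both axes of strong inversion lie in the diagram plane). Projecting along the $x$-axis (to the $y$-$z$-plane) or along the $y$-axis (to the $x$-$z$-plane) gives intravergent diagrams: the axis of the strong inversion is perpendicular to the diagram plane, and the two points of $K$ on this axis project to a central crossing at the origin. All three projections are required to be regular knot diagrams (finitely many multiple points, all of them transverse double points).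 For polygonal knots, vertices should not project onto crossings, with the exception that the points of $K$ lying on the $x$-axis or on the $y$-axis are allowed to be vertices although they project to the central crossing of the corresponding intravergent diagram (near such a point the projection of the curve is point-symmetric about the origin). Simultaneous crossing number. For a knot $K$ having a doubly transvergent diagram, $\operatorname{sim}(K)$ is the minimum, over all symmetric embeddings of $K$ whose three projections are diagrams as described, of the sum of the numbers of crossings of the three diagrams obtained by projecting along the $x$-, $y$- and $z$-axes. *)

theory Defs
  imports "HOL-Analysis.Analysis" "HOL-Library.Extended_Nat"
begin

(* Curves are 1-periodic maps on the real line; a knot is the range of such a curve, as a
   subset of R^3. *)

definition simple_closed_curve :: "(real \<Rightarrow> real^3) \<Rightarrow> bool" where
  "simple_closed_curve \<gamma> \<longleftrightarrow>
     continuous_on UNIV \<gamma> \<and> (\<forall>t. \<gamma> (t + 1) = \<gamma> t) \<and> inj_on \<gamma> {0..<1}"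

(* d n is the n-th derivative. *)
definition smooth_regular_curve :: "(real \<Rightarrow> real^3) \<Rightarrow> bool" where
  "smooth_regular_curve \<gamma> \<longleftrightarrow>
     (\<exists>d :: nat \<Rightarrow> real \<Rightarrow> real^3. d 0 = \<gamma> \<and>
        (\<forall>n t. (d n has_vector_derivative d (Suc n) t) (at t)) \<and> (\<forall>t. d 1 t \<noteq> 0))"

definition polygonal_curve :: "(real \<Rightarrow> real^3) \<Rightarrow> bool" where
  "polygonal_curve \<gamma> \<longleftrightarrow>
     (\<exists>(n::nat) (\<tau> :: nat \<Rightarrow> real). \<tau> 0 = 0 \<and> \<tau> n = 1 \<and>
        (\<forall>i<n. \<tau> i < \<tau> (Suc i) \<and>
           (\<exists>a b. \<forall>t\<in>{\<tau> i..\<tau> (Suc i)}. \<gamma> t = a + t *\<^sub>R b)))"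

definition parametrizes :: "(real \<Rightarrow> real^3) \<Rightarrow> (real^3) set \<Rightarrow> bool" where
  "parametrizes \<gamma> K \<longleftrightarrow>
     simple_closed_curve \<gamma> \<and> (smooth_regular_curve \<gamma> \<or> polygonal_curve \<gamma>) \<and> range \<gamma> = K"

definition knot :: "(real^3) set \<Rightarrow> bool" where
  "knot K \<longleftrightarrow> (\<exists>\<gamma>. parametrizes \<gamma> K)"

definition polygonal_knot :: "(real^3) set \<Rightarrow> bool" where
  "polygonal_knot K \<longleftrightarrow> (\<exists>\<gamma>. simple_closed_curve \<gamma> \<and> polygonal_curve \<gamma> \<and> range \<gamma> = K)"

(* Geometric vertices; only meaningful for polygonal K. Division points of an edge with
   straight angle do not count. *)
definition vertices :: "(real^3) set \<Rightarrow> (real^3) set" where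
  "vertices K = {p\<in>K. \<not> (\<exists>a b. p \<in> open_segment a b \<and> open_segment a b \<subseteq> K)}"

(* Knot type. On smooth and polygonal knots, topological ambient isotopy induces the same
   classes as smooth or piecewise linear ambient isotopy, and isotopy in R^3 the same classes
   as isotopy in S^3. *)
definition same_knot_type :: "(real^3) set \<Rightarrow> (real^3) set \<Rightarrow> bool" where
  "same_knot_type K L \<longleftrightarrow>
     (\<exists>f. homotopic_with_canon (\<lambda>h. \<exists>g. homeomorphism UNIV UNIV h g) UNIV UNIV id f \<and> f ` K = L)"

(* In the rest of the file, u is a unit vector. *)

definition proj_along :: "real^3 \<Rightarrow> real^3 \<Rightarrow> real^3" where
  "proj_along u p = p - (p \<bullet> u) *\<^sub>R u"

definition half_rotation :: "real^3 \<Rightarrow> real^3 \<Rightarrow> real^3" where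
  "half_rotation u p = (2 * (p \<bullet> u)) *\<^sub>R u - p"

abbreviation e_x :: "real^3" where "e_x \<equiv> axis 1 1"
abbreviation e_y :: "real^3" where "e_y \<equiv> axis 2 1"
abbreviation e_z :: "real^3" where "e_z \<equiv> axis 3 1"

(* The multiple points of the projection; in a regular diagram these are the crossings. *)
definition crossings :: "real^3 \<Rightarrow> (real^3) set \<Rightarrow> (real^3) set" where
  "crossings u K = {q. \<exists>p\<in>K. \<exists>p'\<in>K. p \<noteq> p' \<and> proj_along u p = q \<and> proj_along u p' = q}"

(* The parametrization may be chosen to suit q: when a vertex of a polygonal knot lies over q,
   the projected curve is differentiable there for a suitable choice of speeds exactly if it
   runs straight through q. *)
definition transverse_at :: "real^3 \<Rightarrow> (real^3) set \<Rightarrow> real^3 \<Rightarrow> bool" where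
  "transverse_at u K q \<longleftrightarrow>
     (\<exists>\<gamma> s t v w. parametrizes \<gamma> K \<and> \<gamma> s \<noteq> \<gamma> t \<and>
        proj_along u (\<gamma> s) = q \<and> proj_along u (\<gamma> t) = q \<and>
        ((\<lambda>r. proj_along u (\<gamma> r)) has_vector_derivative v) (at s) \<and>
        ((\<lambda>r. proj_along u (\<gamma> r)) has_vector_derivative w) (at t) \<and>
        v \<noteq> w \<and> independent {v, w})"

definition regular_diagram :: "real^3 \<Rightarrow> (real^3) set \<Rightarrow> bool" where
  "regular_diagram u K \<longleftrightarrow>
     finite (crossings u K) \<and>
     (\<forall>q\<in>crossings u K. card {p\<in>K. proj_along u p = q} = 2 \<and> transverse_at u K q)"

definition vertices_avoid_crossings ::
    "real^3 \<Rightarrow> (real^3) set \<Rightarrow> (real^3) set \<Rightarrow> bool" where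
  "vertices_avoid_crossings u K E \<longleftrightarrow>
     (polygonal_knot K \<longrightarrow> (\<forall>v\<in>vertices K - E. proj_along u v \<notin> crossings u K))"

definition crossing_number :: "(real^3) set \<Rightarrow> nat" where
  "crossing_number K =
     Inf {card (crossings u L) | u L.
            knot L \<and> same_knot_type K L \<and> norm u = 1 \<and> regular_diagram u L}"

(* h is a lift to the real line of the map which f induces on the parameter circle. *)
definition reverses_orientation :: "(real^3 \<Rightarrow> real^3) \<Rightarrow> (real^3) set \<Rightarrow> bool" where
  "reverses_orientation f K \<longleftrightarrow>
     (\<exists>\<gamma> (h :: real \<Rightarrow> real). parametrizes \<gamma> K \<and> continuous_on UNIV h \<and>
        (\<forall>s t. s < t \<longrightarrow> h t < h s) \<and> (\<forall>t. f (\<gamma> t) = \<gamma> (h t)))"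

definition symmetric_embedding :: "(real^3) set \<Rightarrow> bool" where
  "symmetric_embedding K \<longleftrightarrow>
     knot K \<and>
     half_rotation e_x ` K = K \<and> half_rotation e_y ` K = K \<and>
     reverses_orientation (half_rotation e_x) K \<and> reverses_orientation (half_rotation e_y) K"

definition has_doubly_transvergent_diagram :: "(real^3) set \<Rightarrow> bool" where
  "has_doubly_transvergent_diagram K \<longleftrightarrow>
     (\<exists>L. same_knot_type K L \<and> symmetric_embedding L \<and>
          regular_diagram e_z L \<and> vertices_avoid_crossings e_z L {})"

(* The points of K on the x-axis (y-axis) may be vertices although they lie over the central
   crossing of the projection along that axis. *)
definition regular_symmetric_embedding :: "(real^3) set \<Rightarrow> bool" where
  "regular_symmetric_embedding K \<longleftrightarrow>
     symmetric_embedding K \<and>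
     regular_diagram e_x K \<and> vertices_avoid_crossings e_x K (span {e_x}) \<and>
     regular_diagram e_y K \<and> vertices_avoid_crossings e_y K (span {e_y}) \<and>
     regular_diagram e_z K \<and> vertices_avoid_crossings e_z K {}"

(* With values in enat, so that a minimum over the empty set would be infinite rather than a
   spurious natural number. *)
definition sim :: "(real^3) set \<Rightarrow> enat" where
  "sim K =
     (INF L \<in> {L. same_knot_type K L \<and> regular_symmetric_embedding L}.
        enat (card (crossings e_x L) + card (crossings e_y L) + card (crossings e_z L)))"

end

theory Submission
  imports Defs
begin

text \<open>
  The bound is a parity argument. The half rotation about the axis of projection preserves the
  knot and acts on the diagram as \<open>q \<mapsto> -q\<close>, so the crossings other than the origin come in pairs,
  and the number of crossings is odd exactly if the origin is a crossing.

  The two strong inversions are orientation reversing involutions of a circle. Such an involution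
  is a reflection: it has exactly two fixed points and exchanges the two arcs between them
  (\<open>strong_inversion_arcs\<close>). Hence the knot meets the \<open>x\<close>-axis and the \<open>y\<close>-axis in two points
  each, and the two intravergent diagrams have an odd number of crossings. The composition of the
  two reflections acts on the knot freely (\<open>inversions_differ\<close>), so the knot misses the
  \<open>z\<close>-axis, and the doubly transvergent diagram has an even number of crossings.

  Each of the three numbers is at least the crossing number \<open>c\<close>. If \<open>c\<close> is odd, the number for
  the transvergent diagram is at least \<open>c + 1\<close>; if \<open>c\<close> is even, those for the two intravergent
  diagrams are.
\<close>

section \<open>Half rotations and the parity of crossings\<close>

lemma half_rotation_involution:
  assumes "norm u = 1"
  shows "half_rotation u (half_rotation u p) = p"
proof -
  have "u \<bullet> u = 1" using assms by (simp add: dot_square_norm)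
  then show ?thesis by (simp add: half_rotation_def inner_diff_left)
qed

lemma half_rotation_eq_iff:
  assumes "norm u = 1"
  shows "half_rotation u p = half_rotation u q \<longleftrightarrow> p = q"
  by (metis assms half_rotation_involution)

lemma half_rotation_fixed_iff: "half_rotation u p = p \<longleftrightarrow> proj_along u p = 0"
proof -
  have "half_rotation u p - p = (-2) *\<^sub>R proj_along u p"
    by (simp add: half_rotation_def proj_along_def algebra_simps scaleR_2)
  then show ?thesis
    by (metis eq_iff_diff_eq_0 scaleR_eq_0_iff neg_equal_0_iff_equal zero_neq_numeral)
qed

lemma proj_along_half_rotation:
  assumes "norm u = 1"
  shows "proj_along u (half_rotation u p) = - proj_along u p"
proof -
  have "u \<bullet> u = 1" using assms by (simp add: dot_square_norm)
  then show ?thesis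
    by (simp add: half_rotation_def proj_along_def inner_diff_left vec_eq_iff)
qed

lemma continuous_on_half_rotation: "continuous_on S (half_rotation u)"
  unfolding half_rotation_def by (intro continuous_intros)

lemma half_rotation_components:
  "half_rotation e_x p = vector [p $ 1, - p $ 2, - p $ 3]"
  "half_rotation e_y p = vector [- p $ 1, p $ 2, - p $ 3]"
  "half_rotation e_z p = vector [- p $ 1, - p $ 2, p $ 3]"
  by (simp_all add: half_rotation_def vec_eq_iff forall_3 inner_axis)
    (simp_all add: axis_def)

lemma half_rotation_xy: "half_rotation e_x (half_rotation e_y p) = half_rotation e_z p"
  by (simp add: half_rotation_components)

lemma half_rotation_commute:
  "half_rotation e_x (half_rotation e_y p) = half_rotation e_y (half_rotation e_x p)"
  by (simp add: half_rotation_components)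

lemma crossings_uminus:
  assumes "norm u = 1" and "half_rotation u ` K = K" and "q \<in> crossings u K"
  shows "- q \<in> crossings u K"
proof -
  let ?r = "half_rotation u"
  obtain p p' where p: "p \<in> K" "p' \<in> K" "p \<noteq> p'" "proj_along u p = q" "proj_along u p' = q"
    using assms(3) by (auto simp: crossings_def)
  have "?r p \<in> K" "?r p' \<in> K" using assms(2) p(1,2) by blast+
  moreover have "?r p \<noteq> ?r p'" using p(3) assms(1) by (simp add: half_rotation_eq_iff)
  moreover have "proj_along u (?r p) = - q" "proj_along u (?r p') = - q"
    using p(4,5) by (simp_all add: proj_along_half_rotation assms(1))
  ultimately show ?thesis unfolding crossings_def mem_Collect_eq by metis
qed

lemma even_card_symmetric:
  fixes S :: "'a::real_vector set"
  assumes "finite S" and "\<And>q. q \<in> S \<Longrightarrow> - q \<in> S" and "0 \<notin> S"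
  shows "even (card S)"
  using assms
proof (induction S rule: finite_psubset_induct)
  case (psubset S)
  show ?case
  proof (cases "S = {}")
    case False
    then obtain q where q: "q \<in> S" by blast
    then have q': "- q \<in> S" "q \<noteq> - q"
      using psubset.prems scaleR_2[of q] by (auto simp: eq_neg_iff_add_eq_0)
    have "- r \<in> S - {q, - q}" if "r \<in> S - {q, - q}" for r
      using that psubset.prems(1)[of r] by (metis Diff_iff insert_iff minus_minus empty_iff)
    then have "even (card (S - {q, - q}))"
      by (intro psubset.IH) (use q psubset.prems in auto)
    moreover have "card (S - {q, - q}) + 2 = card S"
      using card_Diff_subset[of "{q, - q}" S] card_mono[of S "{q, - q}"] q q' psubset.hyps
      by auto
    ultimately show ?thesis by (metis even_add even_numeral)
  qed simp
qed

lemma odd_card_symmetric_iff: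
  fixes S :: "'a::real_vector set"
  assumes "finite S" and "\<And>q. q \<in> S \<Longrightarrow> - q \<in> S"
  shows "odd (card S) \<longleftrightarrow> 0 \<in> S"
proof -
  have "even (card (S - {0}))"
    by (rule even_card_symmetric) (use assms in auto)
  then show ?thesis
    using card.remove[OF assms(1), of 0] by (metis Diff_empty Diff_insert0 even_Suc)
qed

section \<open>Strong inversions of a knot\<close>

lemma simple_closed_curve_shift:
  assumes "simple_closed_curve \<gamma>"
  shows "\<gamma> (t + of_int n) = \<gamma> t"
proof (induction n rule: int_induct[where k = 0])
  case (step1 i)
  then show ?case using assms unfolding simple_closed_curve_def
    by (metis add.assoc of_int_1 of_int_add)
next
  case (step2 i)
  have "\<gamma> (t + of_int (i - 1)) = \<gamma> (t + of_int (i - 1) + 1)"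
    using assms unfolding simple_closed_curve_def by metis
  with step2 show ?case by (simp add: algebra_simps)
qed simp

lemma simple_closed_curve_eq_iff:
  assumes "simple_closed_curve \<gamma>"
  shows "\<gamma> s = \<gamma> t \<longleftrightarrow> s - t \<in> \<int>"
proof
  assume eq: "\<gamma> s = \<gamma> t"
  have frac: "\<gamma> (frac r) = \<gamma> r" for r
    using simple_closed_curve_shift[OF assms, of "frac r" "\<lfloor>r\<rfloor>"] by (simp add: frac_def)
  have "frac s = frac t"
    using assms eq frac[of s] frac[of t] frac_lt_1 frac_ge_0
    unfolding simple_closed_curve_def inj_on_def by (metis atLeastLessThan_iff)
  then have "s - t = of_int (\<lfloor>s\<rfloor> - \<lfloor>t\<rfloor>)" by (simp add: frac_def)
  then show "s - t \<in> \<int>" by (metis Ints_of_int)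
next
  assume "s - t \<in> \<int>"
  then obtain n where "s = t + of_int n" by (metis Ints_cases add.commute diff_add_cancel)
  then show "\<gamma> s = \<gamma> t" using simple_closed_curve_shift[OF assms] by simp
qed

lemma simple_closed_curve_neq:
  assumes "simple_closed_curve \<gamma>" and "s < t" and "t < s + 1"
  shows "\<gamma> s \<noteq> \<gamma> t"
proof
  assume "\<gamma> s = \<gamma> t"
  then obtain n where "t - s = of_int n"
    using simple_closed_curve_eq_iff[OF assms(1)] by (metis Ints_cases)
  then have "0 < (of_int n :: real)" "(of_int n :: real) < 1" using assms by linarith+
  then show False by simp
qed

lemma simple_closed_curve_range:
  assumes "simple_closed_curve \<gamma>"
  shows "range \<gamma> = \<gamma> ` {a..a + 1}"
proof -
  have "\<gamma> t \<in> \<gamma> ` {a..a + 1}" for t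
  proof (rule image_eqI)
    show "\<gamma> t = \<gamma> (a + frac (t - a))"
      using simple_closed_curve_eq_iff[OF assms, of t "a + frac (t - a)"]
      by (simp add: frac_def)
    show "a + frac (t - a) \<in> {a..a + 1}"
      using frac_lt_1[of "t - a"] by (simp add: frac_ge_0 less_imp_le)
  qed
  then show ?thesis by blast
qed

lemma decreasing_attains_shift:
  fixes h :: "real \<Rightarrow> real"
  assumes cont: "continuous_on UNIV h" and dec: "\<And>s t. s < t \<Longrightarrow> h t < h s"
  shows "\<exists>t. h t = t + c"
proof -
  define m where "m = min 0 (h 0 - c)"
  define M where "M = max 0 (h 0 - c)"
  have anti: "h t \<le> h s" if "s \<le> t" for s t
    using dec[of s t] that by (cases "s = t") auto
  have "h M - M \<le> c" "c \<le> h m - m"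
    using anti[of 0 M] anti[of m 0] by (auto simp: m_def M_def)
  moreover have "continuous_on {m..M} (\<lambda>t. h t - t)"
    by (intro continuous_intros continuous_on_subset[OF cont]) auto
  moreover have "m \<le> M" by (simp add: m_def M_def)
  ultimately obtain t where "h t - t = c"
    using IVT2'[of "\<lambda>t. h t - t" M c m] by blast
  then show ?thesis by (intro exI[of _ t]) simp
qed

text \<open>
  A lift of an orientation reversing homeomorphism of the circle has degree \<open>-1\<close>: a drop of two
  or more over one period would pass \<open>h t - 1\<close> strictly inside the period, and there
  \<open>f \<circ> \<gamma>\<close> would take the same value as at \<open>t\<close>.
\<close>
lemma reversing_lift_shift:
  assumes \<gamma>: "simple_closed_curve \<gamma>" and inj: "inj f"
    and cont: "continuous_on UNIV h" and dec: "\<And>s t. s < t \<Longrightarrow> h t < h s"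
    and lift: "\<And>t. f (\<gamma> t) = \<gamma> (h t)"
  shows "h (t + 1) = h t - 1"
proof -
  have "\<gamma> (h (t + 1)) = \<gamma> (h t)"
    using simple_closed_curve_shift[OF \<gamma>, of t 1] lift by (metis of_int_1)
  then obtain n where n: "h t - h (t + 1) = of_int n"
    using simple_closed_curve_eq_iff[OF \<gamma>] by (metis Ints_cases)
  have "0 < (of_int n :: real)" using dec[of t "t + 1"] n by linarith
  then have "1 \<le> n" by simp
  moreover have "n < 2"
  proof (rule ccontr)
    assume "\<not> n < 2"
    then have "(2::real) \<le> of_int n" by simp
    then obtain s where s: "t \<le> s" "s \<le> t + 1" "h s = h t - 1"
      using IVT2'[of h "t + 1" "h t - 1" t] continuous_on_subset[OF cont, of "{t..t + 1}"] n
      by auto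
    have "s \<noteq> t" "s \<noteq> t + 1" using s \<open>2 \<le> of_int n\<close> n by auto
    moreover have "\<gamma> (h s) = \<gamma> (h t)"
      using simple_closed_curve_eq_iff[OF \<gamma>] s by simp
    then have "\<gamma> s = \<gamma> t" using lift inj by (metis injD)
    ultimately show False
      using simple_closed_curve_neq[OF \<gamma>, of t s] s by auto
  qed
  ultimately have "n = 1" by simp
  with n show ?thesis by simp
qed

text \<open>
  With a decreasing lift \<open>h\<close> and parameters with \<open>h t\<^sub>0 = t\<^sub>0\<close> and \<open>h t\<^sub>1 = t\<^sub>1 + 1\<close>, monotonicity
  puts \<open>t\<^sub>0\<close> strictly between \<open>t\<^sub>1\<close> and \<open>t\<^sub>1 + 1\<close>, and the two arcs are the images of
  \<open>[t\<^sub>1, t\<^sub>0]\<close> and \<open>[t\<^sub>0, t\<^sub>1 + 1]\<close>, which \<open>h\<close> exchanges.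
\<close>
lemma strong_inversion_arcs:
  assumes rev: "reverses_orientation f K" and inj: "inj f"
  obtains A B a b where "closed A" "closed B" "A \<union> B = K" "A \<inter> B = {a, b}" "a \<noteq> b"
    "f a = a" "f b = b" "f ` A \<subseteq> B" "f ` B \<subseteq> A"
    "connected (A - {a, b})" "connected (B - {a, b})"
proof -
  obtain \<gamma> h where \<gamma>: "simple_closed_curve \<gamma>" and K: "range \<gamma> = K"
    and h: "continuous_on UNIV h" and dec: "\<And>s t. s < t \<Longrightarrow> h t < h s"
    and lift: "\<And>t. f (\<gamma> t) = \<gamma> (h t)"
    using rev unfolding reverses_orientation_def parametrizes_def by blast
  have cont: "continuous_on S \<gamma>" for S
    using \<gamma> unfolding simple_closed_curve_def by (meson continuous_on_subset subset_UNIV)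
  obtain t0 where t0: "h t0 = t0"
    using decreasing_attains_shift[OF h dec, of 0] by auto
  obtain t1 where t1: "h t1 = t1 + 1"
    using decreasing_attains_shift[OF h dec, of 1] by auto
  have lt: "t1 < t0" using dec[of t0 t1] t0 t1 by (cases t1 t0 rule: linorder_cases) auto
  have lt': "t0 < t1 + 1" using dec[OF lt] t0 t1 by simp
  have anti: "h t \<le> h s" if "s \<le> t" for s t
    using dec[of s t] that by (cases "s = t") auto
  have h1: "h (t1 + 1) = t1"
    using reversing_lift_shift[OF \<gamma> inj h dec lift] t1 by simp
  have wrap: "\<gamma> (t1 + 1) = \<gamma> t1" using \<gamma> unfolding simple_closed_curve_def by blast
  define A where "A = \<gamma> ` {t1..t0}"
  define B where "B = \<gamma> ` {t0..t1 + 1}"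
  have ab: "\<gamma> t0 \<noteq> \<gamma> t1" using simple_closed_curve_neq[OF \<gamma> lt lt'] by simp
  have Aopen: "A - {\<gamma> t0, \<gamma> t1} = \<gamma> ` {t1<..<t0}"
  proof -
    have "{t1..t0} = insert t0 (insert t1 {t1<..<t0})" using lt by auto
    moreover have "\<gamma> t \<noteq> \<gamma> t0" "\<gamma> t \<noteq> \<gamma> t1" if "t \<in> {t1<..<t0}" for t
      using simple_closed_curve_neq[OF \<gamma>, of t t0] simple_closed_curve_neq[OF \<gamma>, of t1 t]
        that lt' by auto
    ultimately show ?thesis unfolding A_def by auto
  qed
  have Bopen: "B - {\<gamma> t0, \<gamma> t1} = \<gamma> ` {t0<..<t1 + 1}"
  proof -
    have "{t0..t1 + 1} = insert t0 (insert (t1 + 1) {t0<..<t1 + 1})" using lt' by auto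
    moreover have "\<gamma> t \<noteq> \<gamma> t0" "\<gamma> t \<noteq> \<gamma> t1" if "t \<in> {t0<..<t1 + 1}" for t
      using simple_closed_curve_neq[OF \<gamma>, of t0 t] simple_closed_curve_neq[OF \<gamma>, of t1 t]
        that lt by auto
    ultimately show ?thesis unfolding B_def by (auto simp: wrap)
  qed
  show thesis
  proof (rule that[of A B "\<gamma> t0" "\<gamma> t1"])
    show "closed A" "closed B"
      unfolding A_def B_def by (intro compact_imp_closed compact_continuous_image cont; simp)+
    have "{t1..t0} \<union> {t0..t1 + 1} = {t1..t1 + 1}" using lt lt' by auto
    then show "A \<union> B = K"
      unfolding A_def B_def K[symmetric] simple_closed_curve_range[OF \<gamma>, of t1]
      by (simp flip: image_Un)
    have "\<gamma> s \<noteq> \<gamma> t" if "s \<in> {t1<..<t0}" "t \<in> {t0<..<t1 + 1}" for s t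
      using simple_closed_curve_neq[OF \<gamma>, of s t] that by auto
    then have "(A - {\<gamma> t0, \<gamma> t1}) \<inter> (B - {\<gamma> t0, \<gamma> t1}) = {}"
      unfolding Aopen Bopen by auto
    moreover have "{\<gamma> t0, \<gamma> t1} \<subseteq> A" using lt by (auto simp: A_def)
    moreover have "{\<gamma> t0, \<gamma> t1} \<subseteq> B"
      using lt' wrap by (auto simp: B_def intro: image_eqI[of _ _ "t1 + 1"])
    ultimately show "A \<inter> B = {\<gamma> t0, \<gamma> t1}" by blast
    have "h t \<in> {t0..t1 + 1}" if "t \<in> {t1..t0}" for t
      using anti[of t t0] anti[of t1 t] that t0 t1 by simp
    then show "f ` A \<subseteq> B"
      unfolding A_def B_def image_image lift by blast
    have "h t \<in> {t1..t0}" if "t \<in> {t0..t1 + 1}" for t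
      using anti[of t0 t] anti[of t "t1 + 1"] that t0 h1 by simp
    then show "f ` B \<subseteq> A"
      unfolding A_def B_def image_image lift by blast
    show "connected (A - {\<gamma> t0, \<gamma> t1})" "connected (B - {\<gamma> t0, \<gamma> t1})"
      unfolding Aopen Bopen by (intro connected_continuous_image cont; simp)+
  qed (use ab t0 t1 wrap in \<open>simp_all add: lift\<close>)
qed

text \<open>
  The image of the open arc \<open>A - E\<close> is connected and avoids \<open>E = A \<inter> B\<close>, so it lies on one
  side; the fixed point \<open>c\<close> decides which.
\<close>
lemma arc_preserved:
  assumes "closed A" "closed B" "A \<inter> B = E" "connected (A - E)"
    and "continuous_on UNIV g" and "g ` (A - E) \<subseteq> A \<union> B - E"
    and "c \<in> A - E" and "g c = c"
  shows "g ` (A - E) \<subseteq> A - E"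
proof -
  have "connected (g ` (A - E))"
    by (intro connected_continuous_image assms continuous_on_subset[OF assms(5)]) simp
  then have "A \<inter> g ` (A - E) = {} \<or> B \<inter> g ` (A - E) = {}"
    using connected_closedD[of "g ` (A - E)" A B] assms by blast
  moreover have "c \<in> A \<inter> g ` (A - E)"
    using assms(7,8) by (metis DiffD1 IntI image_eqI)
  ultimately show ?thesis using assms(6) by blast
qed

text \<open>
  The reflection \<open>f\<close> exchanges the arcs between its fixed points. The other one, \<open>g\<close>, has a
  fixed point on one of these arcs and so preserves it; as it commutes with \<open>f\<close>, it preserves
  both arcs.
\<close>
lemma inversions_differ:
  assumes revf: "reverses_orientation f K" and revg: "reverses_orientation g K"
    and ff: "\<And>p. f (f p) = p" and gg: "\<And>p. g (g p) = p"
    and comm: "\<And>p. f (g p) = g (f p)"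
    and contg: "continuous_on UNIV g" and gK: "g ` K = K"
    and free: "\<And>p. p \<in> K \<Longrightarrow> f p = p \<Longrightarrow> g p \<noteq> p"
    and p: "p \<in> K"
  shows "f p \<noteq> g p"
proof
  assume eq: "f p = g p"
  have injf: "inj f" "inj g" using ff gg by (metis injI)+
  obtain A B a b where AB: "closed A" "closed B" "A \<union> B = K" "A \<inter> B = {a, b}"
    "f a = a" "f b = b" "f ` A \<subseteq> B" "f ` B \<subseteq> A"
    "connected (A - {a, b})" "connected (B - {a, b})"
    by (rule strong_inversion_arcs[OF revf injf(1)])
  have fixf: "q \<in> {a, b}" if "q \<in> K" "f q = q" for q
    using AB(3,4,7,8) that by (metis IntI UnE image_subset_iff)
  have E: "g q \<in> {a, b} \<longleftrightarrow> q \<in> {a, b}" if "q \<in> K" for q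
    using that AB(3-6) fixf comm gg gK by (metis IntD1 UnI1 image_eqI insertCI insertE singletonD)
  have pE: "p \<notin> {a, b}" using eq free p AB(5,6) by (metis insertE singletonD)
  obtain c where c: "c \<in> K" "g c = c"
    by (rule strong_inversion_arcs[OF revg injf(2)]) blast
  have cE: "c \<notin> {a, b}" using c free AB(5,6) by (metis insertE singletonD)
  have maps: "g ` (A - {a, b}) \<subseteq> A \<union> B - {a, b}" "g ` (B - {a, b}) \<subseteq> B \<union> A - {a, b}"
    using E gK AB(3) by blast+
  have transfer: "g ` (D - {a, b}) \<subseteq> D"
    if "g ` (C - {a, b}) \<subseteq> C - {a, b}" "f ` C \<subseteq> D" "f ` D \<subseteq> C" for C D
  proof
    fix r assume "r \<in> g ` (D - {a, b})"
    then obtain q where q: "q \<in> D" "q \<notin> {a, b}" "r = g q" by blast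
    then have "f q \<in> C - {a, b}" using that(3) AB(5,6) ff
      by (metis DiffI image_subset_iff insertE insertCI singletonD)
    then have "f (g (f q)) \<in> D" using that by blast
    then show "r \<in> D" using q comm ff by metis
  qed
  have "g ` (A - {a, b}) \<subseteq> A \<and> g ` (B - {a, b}) \<subseteq> B"
  proof (cases "c \<in> A")
    case True
    then have "g ` (A - {a, b}) \<subseteq> A - {a, b}"
      using arc_preserved[OF AB(1,2,4,9) contg maps(1)] c cE by blast
    then show ?thesis using transfer AB(7,8) by blast
  next
    case False
    then have "g ` (B - {a, b}) \<subseteq> B - {a, b}"
      using arc_preserved[OF AB(2,1) _ AB(10) contg maps(2)] c cE AB(3,4)
      by (metis DiffI Int_commute UnE)
    then show ?thesis using transfer AB(7,8) by blast
  qed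
  then have "g p \<in> A \<inter> B"
    using p pE AB(3,7,8) eq by (metis DiffI IntI UnE image_subset_iff)
  then show False using E[OF p] pE AB(4) by blast
qed

section \<open>The three diagrams of a symmetric embedding\<close>

lemma zero_in_crossings_axis:
  assumes "reverses_orientation (half_rotation u) K" and "norm u = 1"
  shows "0 \<in> crossings u K"
proof -
  have "inj (half_rotation u)" by (simp add: inj_def half_rotation_eq_iff assms(2))
  then obtain a b where "a \<in> K" "b \<in> K" "a \<noteq> b" "half_rotation u a = a" "half_rotation u b = b"
    by (rule strong_inversion_arcs[OF assms(1)]) blast
  then show ?thesis unfolding crossings_def half_rotation_fixed_iff by blast
qed

text \<open>
  The half rotation about the \<open>y\<close>-axis acts as \<open>p \<mapsto> -p\<close> on the \<open>x\<close>-axis. If the origin were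
  one of the two points of the knot on the \<open>x\<close>-axis, the other one, \<open>q\<close>, would bring along a
  third, \<open>-q\<close>.
\<close>
lemma zero_notin_symmetric_embedding:
  assumes "symmetric_embedding K"
  shows "0 \<notin> K"
proof
  assume "0 \<in> K"
  let ?f = "half_rotation e_x" and ?g = "half_rotation e_y"
  have inj: "inj ?f" by (simp add: inj_def half_rotation_eq_iff)
  have rev: "reverses_orientation ?f K" and gK: "?g ` K = K"
    using assms by (auto simp: symmetric_embedding_def)
  obtain A B a b where AB: "A \<union> B = K" "A \<inter> B = {a, b}" "a \<noteq> b"
    "?f a = a" "?f b = b" "?f ` A \<subseteq> B" "?f ` B \<subseteq> A"
    by (rule strong_inversion_arcs[OF rev inj])
  have fixed: "q \<in> {a, b}" if "q \<in> K" "?f q = q" for q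
    using AB(1,2,6,7) that by (metis IntI UnE image_subset_iff)
  have "0 \<in> {a, b}" by (rule fixed) (use \<open>0 \<in> K\<close> in \<open>simp_all add: half_rotation_def\<close>)
  then obtain q where q: "q \<in> {a, b}" "q \<noteq> 0" "{a, b} = {0, q}" using AB(3) by blast
  have fq: "?f q = q" using q AB by auto
  have "q $ 2 = (- q) $ 2" "q $ 3 = (- q) $ 3"
    using arg_cong[OF fq, of "\<lambda>r. r $ 2"] arg_cong[OF fq, of "\<lambda>r. r $ 3"]
    by (simp_all add: half_rotation_components)
  then have gq: "?g q = - q"
    by (simp add: half_rotation_components vec_eq_iff forall_3)
  have "q \<in> K" using q AB by blast
  then have "- q \<in> K" using gK gq by (metis image_eqI)
  moreover have "?f (- q) = - ?f q" by (simp add: half_rotation_def)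
  ultimately have "- q \<in> {0, q}" using fixed q(3) fq by metis
  then show False using q(2) scaleR_2[of q] by (auto simp: neg_eq_iff_add_eq_0)
qed

lemma zero_notin_crossings_z:
  assumes "symmetric_embedding K"
  shows "0 \<notin> crossings e_z K"
proof
  let ?f = "half_rotation e_x" and ?g = "half_rotation e_y"
  assume "0 \<in> crossings e_z K"
  then obtain p where p: "p \<in> K" "half_rotation e_z p = p"
    unfolding crossings_def half_rotation_fixed_iff by blast
  have "?f p \<noteq> ?g p"
  proof (rule inversions_differ[of ?f K ?g p])
    show "?g q \<noteq> q" if "q \<in> K" "?f q = q" for q
    proof
      assume "?g q = q"
      then have "q = 0"
        using that(2) by (simp add: half_rotation_components vec_eq_iff forall_3)
      then show False using zero_notin_symmetric_embedding[OF assms] that(1) by simp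
    qed
  qed (use assms p in \<open>auto simp: symmetric_embedding_def half_rotation_involution
      half_rotation_commute continuous_on_half_rotation\<close>)
  moreover have "?f p = ?g p"
    using p(2) half_rotation_xy[of p] half_rotation_involution[of e_x] by (metis norm_axis_1)
  ultimately show False by blast
qed

lemma crossing_number_le:
  assumes "knot L" "same_knot_type K L" "norm u = 1" "regular_diagram u L"
  shows "crossing_number K \<le> card (crossings u L)"
  unfolding crossing_number_def by (rule cInf_lower) (use assms in auto)

theorem mainTheorem2:
  fixes K :: "(real^3) set"
  assumes "knot K" and "has_doubly_transvergent_diagram K"
  shows "(if odd (crossing_number K) then enat (3 * crossing_number K + 1)
          else enat (3 * crossing_number K + 2)) \<le> sim K
       \<and> sim K \<noteq> enat (3 * crossing_number K)"
proof -
  let ?c = "crossing_number K"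
  define m where "m = (if odd ?c then 3 * ?c + 1 else 3 * ?c + 2)"
  have "enat m \<le> sim K"
    unfolding sim_def
  proof (rule INF_greatest, clarsimp)
    fix L assume type: "same_knot_type K L" and L: "regular_symmetric_embedding L"
    then have emb: "symmetric_embedding L"
      and reg: "regular_diagram e_x L" "regular_diagram e_y L" "regular_diagram e_z L"
      by (auto simp: regular_symmetric_embedding_def)
    have rot: "half_rotation e_x ` L = L" "half_rotation e_y ` L = L"
      using emb by (auto simp: symmetric_embedding_def)
    then have rotz: "half_rotation e_z ` L = L"
      by (simp flip: half_rotation_xy add: image_image[symmetric])
    have parity: "odd (card (crossings u L)) \<longleftrightarrow> 0 \<in> crossings u L"
      if "norm u = 1" "half_rotation u ` L = L" "regular_diagram u L" for u
      by (rule odd_card_symmetric_iff)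
        (use that crossings_uminus in \<open>auto simp: regular_diagram_def\<close>)
    have "odd (card (crossings e_x L))" "odd (card (crossings e_y L))"
      using emb reg rot by (simp_all add: parity zero_in_crossings_axis symmetric_embedding_def)
    moreover have "even (card (crossings e_z L))"
      using parity[of e_z] reg(3) rotz zero_notin_crossings_z[OF emb] by simp
    moreover have "?c \<le> card (crossings e_x L)" "?c \<le> card (crossings e_y L)"
      "?c \<le> card (crossings e_z L)"
      using emb type reg by (auto intro!: crossing_number_le simp: symmetric_embedding_def)
    ultimately show "m \<le> card (crossings e_x L) + card (crossings e_y L) + card (crossings e_z L)"
      unfolding m_def by presburger
  qed
  then show ?thesis by (auto simp: m_def split: if_splits)
qed

end
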